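(* Let $n,k$ be integers with $n/2<k<n$. In the knights-and-spies searching problem in which spies are unconstrained, $\widetilde{T}_S(n,k)=n-1$ and $\overline{T}_S(n,k)=n$.
   Context: There are $n$ people, numbered $1,\dots,n$, each of whom is either a knight or a spy. It is known that at least $k$ of them are knights, where $n/2<k<n$. The only permitted questions have the form "Person $x$, is Person $y$ a spy?" with $x\neq y$, answered "yes" or "no" by Person $x$. Knights always answer truthfully; spies are unconstrained, i.e. each spy may answer each question truthfully or falsely as they see fit (adversarially). Questions are adaptive. A number of questions is "necessary and sufficient" for a task if some adaptive strategy accomplishes the task within that many questions for every consistent assignment of identities and every behaviour of the spies, and no strategy with fewer questions does. $\overline{T}_S(n,k)$ is the number of questions necessary and sufficient either to identify a spy or to correctly conclude that everyone is a knight. $\widetilde{T}_S(n,k)$ is the number of questions necessary and sufficient to identify a spy when it is known that at least one spy is present. *)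

theory Defs
  imports Complex_Main "HOL-Library.Extended_Nat"
begin

text \<open>
  People are the numbers \<open>1, \<dots>, n\<close>. An assignment of identities is given by its set \<open>K\<close> of
  knights; everybody else in \<open>{1..n}\<close> is a spy.
\<close>

definition assignments :: "nat \<Rightarrow> nat \<Rightarrow> nat set set" where
  "assignments n k = {K. K \<subseteq> {1..n} \<and> k \<le> card K}"

text \<open>
  \<open>((x, y), a)\<close> records that person \<open>x\<close> was asked ``is person \<open>y\<close> a spy?'' and answered \<open>a\<close>,
  where \<open>True\<close> means ``yes''.
\<close>

type_synonym history = "((nat \<times> nat) \<times> bool) list"

text \<open>
  The joint behaviour of the spies: any function of the questions and answers so far, the person
  asked and the person asked about. In particular a spy may answer the same question
  differently on different occasions.
\<close>

type_synonym behaviour = "history \<Rightarrow> nat \<Rightarrow> nat \<Rightarrow> bool"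

definition answer :: "nat set \<Rightarrow> behaviour \<Rightarrow> history \<Rightarrow> nat \<Rightarrow> nat \<Rightarrow> bool" where
  "answer K \<beta> h x y = (if x \<in> K then y \<notin> K else \<beta> h x y)"

text \<open>
  An adaptive strategy is a decision tree: \<open>Ask x y s t\<close> asks person \<open>x\<close> whether person \<open>y\<close> is a
  spy and continues with \<open>s\<close> after the answer ``yes'' and with \<open>t\<close> after the answer ``no''.
\<close>

datatype 'c strategy = Conclude 'c | Ask nat nat "'c strategy" "'c strategy"

primrec permitted :: "nat \<Rightarrow> 'c strategy \<Rightarrow> bool" where
  "permitted n (Conclude c) \<longleftrightarrow> True"
| "permitted n (Ask x y s t) \<longleftrightarrow>
     x \<in> {1..n} \<and> y \<in> {1..n} \<and> x \<noteq> y \<and> permitted n s \<and> permitted n t"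

primrec run :: "nat set \<Rightarrow> behaviour \<Rightarrow> 'c strategy \<Rightarrow> history \<Rightarrow> 'c \<times> history" where
  "run K \<beta> (Conclude c) h = (c, h)"
| "run K \<beta> (Ask x y s t) h =
     (if answer K \<beta> h x y
      then run K \<beta> s (h @ [((x, y), True)])
      else run K \<beta> t (h @ [((x, y), False)]))"

text \<open>
  A task is given by the set \<open>\<A>\<close> of assignments known to be possible and by a relation saying
  which conclusions are correct for which assignment.
\<close>

definition accomplishes ::
  "nat \<Rightarrow> nat set set \<Rightarrow> (nat set \<Rightarrow> 'c \<Rightarrow> bool) \<Rightarrow> nat \<Rightarrow> 'c strategy \<Rightarrow> bool" where
  "accomplishes n \<A> correct q s \<longleftrightarrow>
     permitted n s \<and>
     (\<forall>K\<in>\<A>. \<forall>\<beta>. case run K \<beta> s [] of (c, h) \<Rightarrow> correct K c \<and> length h \<le> q)"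

text \<open>
  The least sufficient number of questions; it is \<open>\<infinity>\<close> if no number of questions suffices, so
  equality with a finite number includes the existence of an optimal strategy.
\<close>

definition questions_needed ::
  "nat \<Rightarrow> nat set set \<Rightarrow> (nat set \<Rightarrow> 'c \<Rightarrow> bool) \<Rightarrow> enat" where
  "questions_needed n \<A> correct = Inf (enat ` {q. \<exists>s. accomplishes n \<A> correct q s})"

datatype verdict = Spy nat | All_Knights

primrec correct_verdict :: "nat \<Rightarrow> nat set \<Rightarrow> verdict \<Rightarrow> bool" where
  "correct_verdict n K (Spy p) \<longleftrightarrow> p \<in> {1..n} - K"
| "correct_verdict n K All_Knights \<longleftrightarrow> K = {1..n}"

definition T_bar_S :: "nat \<Rightarrow> nat \<Rightarrow> enat" where
  "T_bar_S n k = questions_needed n (assignments n k) (correct_verdict n)"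

definition T_tilde_S :: "nat \<Rightarrow> nat \<Rightarrow> enat" where
  "T_tilde_S n k =
     questions_needed n {K \<in> assignments n k. {1..n} - K \<noteq> {}} (\<lambda>K p. p \<in> {1..n} - K)"

end

(*
  Since spies are unconstrained, only the set of assignments consistent with the answers so far
  matters: asking x about y splits it into two, which overlap in the assignments where x is a spy.

  Lower bounds: always answer "no". An assignment whose only spy is p stays consistent as long as
  nobody is asked about p, and every question is about only one person.

  Upper bounds: ask 1 about 2, 2 about 3, and so on. If no answer is "yes", the spies form an initial
  segment, and in the problem where all may be knights a last question to n about 1 decides.
  After the first "yes", given by x about y, keep x as candidate, with a set A all of
  which are spies if x is a spy and a set B all of which are spies if x is a knight; initially
  A = {1..x} and B = {y}. Each new person is asked about x and joins A or B. Once A and B have equal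
  size, half of their union are spies; discard them, saving one question, and start
  again with a new candidate. Knights keep their majority, so the last candidate is a knight:
  anybody in B is then a spy, and if B is empty the saved question, asked about a
  discarded candidate, yields one.
*)
theory Submission
  imports Defs
begin

section \<open>Strategies as splittings of sets of assignments\<close>

text \<open>The two subsets are what remains after "yes" and after "no". No history is kept, since
  spies may choose each answer afresh. \<open>conclude\<close> leaves \<open>q\<close> free, so
  \<open>q\<close> is only an upper bound.\<close>

inductive solvable :: "nat \<Rightarrow> (nat set \<Rightarrow> 'c \<Rightarrow> bool) \<Rightarrow> nat \<Rightarrow> nat set set \<Rightarrow> bool"
  for n :: nat and correct :: "nat set \<Rightarrow> 'c \<Rightarrow> bool" where
  conclude: "(\<And>K. K \<in> \<A> \<Longrightarrow> correct K c) \<Longrightarrow> solvable n correct q \<A>"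
| ask: "x \<in> {1..n} \<Longrightarrow> y \<in> {1..n} \<Longrightarrow> x \<noteq> y \<Longrightarrow>
    solvable n correct q {K \<in> \<A>. x \<in> K \<longrightarrow> y \<notin> K} \<Longrightarrow>
    solvable n correct q {K \<in> \<A>. x \<in> K \<longrightarrow> y \<in> K} \<Longrightarrow>
    solvable n correct (Suc q) \<A>"

text \<open>Histories only grow, so a run never consults the behaviour at shorter ones. This allows
  one answer to be altered without touching the rest of the run.\<close>

lemma run_cong:
  assumes "\<And>g. length h \<le> length g \<Longrightarrow> \<beta> g = \<beta>' g"
  shows "run K \<beta> s h = run K \<beta>' s h"
  using assms
proof (induction s arbitrary: h)
  case (Ask x y s t)
  have "answer K \<beta> h x y = answer K \<beta>' h x y"
    using Ask.prems by (simp add: answer_def)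
  moreover have "run K \<beta> s (h @ [((x, y), True)]) = run K \<beta>' s (h @ [((x, y), True)])"
    using Ask.prems by (intro Ask.IH) auto
  moreover have "run K \<beta> t (h @ [((x, y), False)]) = run K \<beta>' t (h @ [((x, y), False)])"
    using Ask.prems by (intro Ask.IH) auto
  ultimately show ?case by simp
qed simp

lemma length_run_ge: "length h \<le> length (snd (run K \<beta> s h))"
proof (induction s arbitrary: h)
  case (Ask x y s t)
  then show ?case
    using Ask.IH(1)[of "h @ [((x, y), True)]"] Ask.IH(2)[of "h @ [((x, y), False)]"] by simp
qed simp

lemma strategy_if_solvable:
  assumes "solvable n correct q \<A>"
  shows "\<exists>s. permitted n s \<and> (\<forall>K\<in>\<A>. \<forall>\<beta> h.
    correct K (fst (run K \<beta> s h)) \<and> length (snd (run K \<beta> s h)) \<le> q + length h)"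
  using assms
proof induction
  case (conclude \<A> c q)
  then show ?case by (intro exI[of _ "Conclude c"]) auto
next
  case (ask x y q \<A>)
  then obtain s t where "permitted n s" "permitted n t"
    and s: "\<And>K \<beta> h. K \<in> \<A> \<Longrightarrow> x \<in> K \<longrightarrow> y \<notin> K \<Longrightarrow>
      correct K (fst (run K \<beta> s h)) \<and> length (snd (run K \<beta> s h)) \<le> q + length h"
    and t: "\<And>K \<beta> h. K \<in> \<A> \<Longrightarrow> x \<in> K \<longrightarrow> y \<in> K \<Longrightarrow>
      correct K (fst (run K \<beta> t h)) \<and> length (snd (run K \<beta> t h)) \<le> q + length h"
    by auto
  have "correct K (fst (run K \<beta> (Ask x y s t) h)) \<and>
      length (snd (run K \<beta> (Ask x y s t) h)) \<le> Suc q + length h" if "K \<in> \<A>" for K \<beta> h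
    using s[OF that, of \<beta> "h @ [((x, y), True)]"] t[OF that, of \<beta> "h @ [((x, y), False)]"]
    by (auto simp: answer_def)
  then show ?case
    using ask.hyps \<open>permitted n s\<close> \<open>permitted n t\<close> by (intro exI[of _ "Ask x y s t"]) auto
qed

lemma solvable_if_strategy:
  assumes "permitted n s"
    and "\<And>K \<beta>. K \<in> \<A> \<Longrightarrow>
      correct K (fst (run K \<beta> s h)) \<and> length (snd (run K \<beta> s h)) \<le> q + length h"
  shows "solvable n correct q \<A>"
  using assms
proof (induction s arbitrary: q \<A> h)
  case (Conclude c)
  then show ?case by (intro solvable.conclude[of _ _ c]) auto
next
  case (Ask x y s t)
  show ?case
  \<comment> \<open>Without any assignment the length bound says nothing and \<open>q\<close> may be
    0; otherwise some run asks at least one question.\<close>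
  proof (cases "\<A> = {}")
    case True
    then show ?thesis by (intro solvable.conclude) auto
  next
    case False
    then obtain K0 where "K0 \<in> \<A>" by blast
    then have "Suc (length h) \<le> q + length h"
      using Ask.prems(2)[OF \<open>K0 \<in> \<A>\<close>, of undefined]
        length_run_ge[of "h @ [((x, y), True)]" K0 undefined s]
        length_run_ge[of "h @ [((x, y), False)]" K0 undefined t]
      by (simp split: if_splits)
    then obtain p where q: "q = Suc p" by (cases q) auto
    have forced: "correct K (fst (run K \<beta> u (h @ [((x, y), a)]))) \<and>
        length (snd (run K \<beta> u (h @ [((x, y), a)]))) \<le> p + length (h @ [((x, y), a)])"
      if "K \<in> \<A>" "x \<in> K \<longrightarrow> a = (y \<notin> K)" "u = (if a then s else t)" for K \<beta> u a
    proof -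
      \<comment> \<open>Patching the behaviour at \<open>h\<close> alone makes a spy give the answer
        \<open>a\<close> now; if \<open>x\<close> is a knight, \<open>a\<close> is the true answer
        anyway.\<close>
      define \<beta>' where "\<beta>' = \<beta>(h := \<lambda>_ _. a)"
      have "run K \<beta>' u (h @ [((x, y), a)]) = run K \<beta> u (h @ [((x, y), a)])"
        by (rule run_cong) (auto simp: \<beta>'_def)
      moreover have "answer K \<beta>' h x y = a"
        using that by (simp add: answer_def \<beta>'_def)
      ultimately show ?thesis
        using Ask.prems(2)[OF \<open>K \<in> \<A>\<close>, of \<beta>'] that(3) q by (auto split: if_splits)
    qed
    show ?thesis unfolding q
    proof (rule solvable.ask)
      show "solvable n correct p {K \<in> \<A>. x \<in> K \<longrightarrow> y \<notin> K}"
        using Ask.prems(1) forced[of _ True] by (intro Ask.IH(1)) auto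
      show "solvable n correct p {K \<in> \<A>. x \<in> K \<longrightarrow> y \<in> K}"
        using Ask.prems(1) forced[of _ False] by (intro Ask.IH(2)) auto
    qed (use Ask.prems(1) in auto)
  qed
qed

lemma ex_accomplishes_iff_solvable:
  "(\<exists>s. accomplishes n \<A> correct q s) \<longleftrightarrow> solvable n correct q \<A>"
proof
  assume "\<exists>s. accomplishes n \<A> correct q s"
  then show "solvable n correct q \<A>"
    by (auto simp: accomplishes_def case_prod_beta intro: solvable_if_strategy[where h = "[]"])
next
  assume "solvable n correct q \<A>"
  from strategy_if_solvable[OF this] obtain s where "permitted n s"
    and "\<And>K \<beta> h. K \<in> \<A> \<Longrightarrow>
      correct K (fst (run K \<beta> s h)) \<and> length (snd (run K \<beta> s h)) \<le> q + length h"
    by blast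
  from this(1) this(2)[where h = "[]"] show "\<exists>s. accomplishes n \<A> correct q s"
    by (auto simp: accomplishes_def case_prod_beta)
qed

lemma questions_needed_eqI:
  assumes "solvable n correct m \<A>"
    and "\<And>q. solvable n correct q \<A> \<Longrightarrow> m \<le> q"
  shows "questions_needed n \<A> correct = enat m"
  unfolding questions_needed_def ex_accomplishes_iff_solvable
  using assms by (intro antisym Inf_lower Inf_greatest) auto

lemma solvable_mono:
  assumes "solvable n correct q \<A>" and "q \<le> q'"
  shows "solvable n correct q' \<A>"
  using assms
proof (induction arbitrary: q')
  case (conclude \<A> c q)
  then show ?case by (auto intro: solvable.conclude)
next
  case (ask x y q \<A>)
  obtain p where "q' = Suc p" "q \<le> p"
    using ask.prems by (cases q') auto
  then show ?case
    using ask by (auto intro!: solvable.ask[of x n y])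
qed

section \<open>Lower bounds\<close>

text \<open>\<open>P\<close> holds those who may be the only spy. The answer "no" about
  \<open>y\<close> eliminates at most \<open>y\<close> from \<open>P\<close>, and a conclusion is
  right for at most one member.\<close>

lemma suspects_le_if_solvable_spy:
  assumes "solvable n (\<lambda>K p. p \<in> {1..n} - K) q \<A>"
    and "P \<subseteq> {1..n}" "\<And>p. p \<in> P \<Longrightarrow> {1..n} - {p} \<in> \<A>"
  shows "card P \<le> Suc q"
  using assms
proof (induction arbitrary: P)
  case (conclude \<A> c q)
  then have "P \<subseteq> {c}" by fastforce
  then show ?case using card_mono[of "{c}" P] by simp
next
  case (ask x y q \<A>)
  have "card (P - {y}) \<le> Suc q"
    using ask.prems ask.hyps by (intro ask.IH(2)) auto
  then show ?case
    using diff_card_le_card_Diff[of "{y}" P] by simp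
qed

lemma suspects_le_if_solvable_verdict:
  assumes "solvable n (correct_verdict n) q \<A>"
    and "P \<subseteq> {1..n}" "{1..n} \<in> \<A>" "\<And>p. p \<in> P \<Longrightarrow> {1..n} - {p} \<in> \<A>"
  shows "card P \<le> q"
  using assms
proof (induction arbitrary: P)
  case (conclude \<A> c q)
  \<comment> \<open>\<open>All_Knights\<close> is wrong for any suspect, and a named spy is wrong
    for \<open>{1..n}\<close>, which every "no" leaves possible.\<close>
  have "P = {}"
  proof (rule ccontr)
    assume "P \<noteq> {}"
    then obtain p where "p \<in> P" by blast
    then show False
      using conclude.hyps[OF conclude.prems(2)] conclude.hyps[OF conclude.prems(3)]
        conclude.prems(1) by (cases c) auto
  qed
  then show ?case by simp
next
  case (ask x y q \<A>)
  have "card (P - {y}) \<le> q"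
    using ask.prems ask.hyps by (intro ask.IH(2)) auto
  then show ?case
    using diff_card_le_card_Diff[of "{y}" P] by simp
qed

section \<open>Upper bounds\<close>

text \<open>
  The pair \<open>z\<close>, \<open>w\<close> serves when the last candidate, a certified knight, has \<open>B = {}\<close>: asking
  about \<open>z\<close> then exhibits a spy. The people outside \<open>U \<union> A \<union> B\<close> have been discarded.
\<close>

lemma solvable_with_candidate:
  fixes correct :: "nat set \<Rightarrow> 'c \<Rightarrow> bool"
  assumes spy: "\<And>K p. p \<in> {1..n} - K \<Longrightarrow> correct K (spy p)"
    and "U \<union> A \<union> B \<subseteq> {1..n}" "U \<inter> A = {}" "U \<inter> B = {}" "A \<inter> B = {}"
    and "x \<in> A" "card B \<le> card A" "z \<in> {1..n}" "w \<in> {1..n}"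
    and "\<And>K. K \<in> \<A> \<Longrightarrow> x \<in> K \<Longrightarrow> B \<inter> K = {}"
    and "\<And>K. K \<in> \<A> \<Longrightarrow> x \<notin> K \<Longrightarrow> A \<inter> K = {}"
    and "\<And>K. K \<in> \<A> \<Longrightarrow> z \<in> K \<Longrightarrow> w \<notin> K"
    and "\<And>K. K \<in> \<A> \<Longrightarrow> 2 * card ((U \<union> A \<union> B) - K) < card (U \<union> A \<union> B)"
    and "q = card U + (if B = {} then 1 else 0)"
  shows "solvable n correct q \<A>"
  using assms(2-)
proof (induction "card U" arbitrary: U A B x z w \<A> q rule: less_induct)
  case less
  note prems = less.prems
  have fin: "finite U" "finite A" "finite B"
    using prems(1) finite_subset[of _ "{1..n}"] by auto
  have cardAB: "card (A \<union> B) = card A + card B"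
    using fin prems(4) by (simp add: card_Un_disjoint)
  have cardUAB: "card (U \<union> A \<union> B) = card U + card A + card B"
    using fin prems(2-4) by (simp add: card_Un_disjoint Int_Un_distrib2)
  consider "U = {}" | "U \<noteq> {}" "card A = card B" | "U \<noteq> {}" "card B < card A"
    using prems(6) by linarith
  then show ?case
  proof cases
    case 1
    \<comment> \<open>If the candidate were a spy, all of \<open>A\<close>, at least half of those
      left, would be spies.\<close>
    have knight: "x \<in> K" if "K \<in> \<A>" for K
    proof (rule ccontr)
      assume "x \<notin> K"
      then have "A \<subseteq> (U \<union> A \<union> B) - K" using prems(10)[OF that] by auto
      then have "card A \<le> card ((U \<union> A \<union> B) - K)" using fin by (intro card_mono) auto
      then show False using prems(12)[OF that] cardUAB 1 prems(6) by simp
    qed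
    show ?thesis
    proof (cases "B = {}")
      case False
      then obtain b where "b \<in> B" by blast
      then show ?thesis
        using knight prems(1,9) by (intro solvable.conclude[of _ _ "spy b"] spy) auto
    next
      case True
      then have q: "q = Suc 0" using 1 prems(13) by simp
      show ?thesis
      \<comment> \<open>Nobody can be asked about himself; here \<open>z\<close> is the certified
        knight, so \<open>w\<close> is a spy.\<close>
      proof (cases "x = z")
        case True
        then show ?thesis
          using knight prems(8,11) by (intro solvable.conclude[of _ _ "spy w"] spy) auto
      next
        case False
        have "solvable n correct 0 {K \<in> \<A>. x \<in> K \<longrightarrow> z \<notin> K}"
          using knight prems(7) by (intro solvable.conclude[of _ _ "spy z"] spy) auto
        moreover have "solvable n correct 0 {K \<in> \<A>. x \<in> K \<longrightarrow> z \<in> K}"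
          using knight prems(8,11) by (intro solvable.conclude[of _ _ "spy w"] spy) auto
        ultimately show ?thesis
          unfolding q using False prems(1,5,7) by (intro solvable.ask[of x n z]) auto
      qed
    qed
  next
    case 2
    then obtain u where u: "u \<in> U" by blast
    have "B \<noteq> {}" using 2 prems(5) fin by auto
    then obtain b where b: "b \<in> B" by blast
    have cardU: "card U = Suc (card (U - {u}))"
      using u fin by (metis card_Suc_Diff1)
    show ?thesis
    \<comment> \<open>The new candidate \<open>u\<close> is taken without a question, which pays for
      the extra 1 due while \<open>B\<close> is empty. The old candidate and \<open>b\<close> form
      the new pair.\<close>
    proof (rule less.hyps[of "U - {u}" "{u}" "{}" u x b])
      fix K assume K: "K \<in> \<A>"
      have "card A \<le> card ((A \<union> B) - K)"
      proof (cases "x \<in> K")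
        case True
        then have "B \<subseteq> (A \<union> B) - K" using prems(9)[OF K] by auto
        then show ?thesis using fin 2 by (simp add: card_mono)
      next
        case False
        then have "A \<subseteq> (A \<union> B) - K" using prems(10)[OF K] by auto
        then show ?thesis using fin by (simp add: card_mono)
      qed
      moreover have "card ((U \<union> A \<union> B) - K) = card (U - K) + card ((A \<union> B) - K)"
      proof -
        have "(U \<union> A \<union> B) - K = (U - K) \<union> ((A \<union> B) - K)" by auto
        then show ?thesis
          using fin prems(2,3) by (simp only:) (rule card_Un_disjoint; auto)
      qed
      ultimately have "2 * card (U - K) < card U"
        using prems(12)[OF K] cardUAB 2 by linarith
      then show "2 * card ((U - {u}) \<union> {u} \<union> {} - K) < card ((U - {u}) \<union> {u} \<union> {})"
        using u by (simp add: insert_absorb)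
      show "b \<notin> K" if "x \<in> K" using prems(9)[OF K that] b by auto
    qed (use cardU prems(1,5,13) u b \<open>B \<noteq> {}\<close> in auto)
  next
    case 3
    then obtain u where u: "u \<in> U" by blast
    have cardU: "card U = Suc (card (U - {u}))"
      using u fin by (metis card_Suc_Diff1)
    then have "q \<noteq> 0" using prems(13) by linarith
    then obtain p where q: "q = Suc p" using not0_implies_Suc by blast
    have unA: "(U - {u}) \<union> insert u A \<union> B = U \<union> A \<union> B"
      and unB: "(U - {u}) \<union> A \<union> insert u B = U \<union> A \<union> B"
      using u by auto
    \<comment> \<open>After "no", \<open>u\<close> is a spy if \<open>x\<close> is one, and joins
      \<open>A\<close>.\<close>
    have "solvable n correct p {K \<in> \<A>. u \<in> K \<longrightarrow> x \<in> K}"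
    proof (rule less.hyps[of "U - {u}" "insert u A" B x z w])
      show "card B \<le> card (insert u A)" using prems(6) card_insert_le[of A u] by linarith
      show "2 * card ((U - {u}) \<union> insert u A \<union> B - K) < card ((U - {u}) \<union> insert u A \<union> B)"
        if "K \<in> {K \<in> \<A>. u \<in> K \<longrightarrow> x \<in> K}" for K
        using prems(12)[of K] that unfolding unA by blast
      show "p = card (U - {u}) + (if B = {} then 1 else 0)" using q prems(13) cardU by simp
    qed (use cardU prems(1-11) u in auto)
    \<comment> \<open>After "yes", \<open>u\<close> joins \<open>B\<close>, which still fits since
      \<open>card B < card A\<close>. As \<open>B\<close> is now nonempty, the extra question, if
      there was one, is left over.\<close>
    moreover have "solvable n correct p {K \<in> \<A>. u \<in> K \<longrightarrow> x \<notin> K}"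
    proof (rule solvable_mono)
      show "solvable n correct (card (U - {u})) {K \<in> \<A>. u \<in> K \<longrightarrow> x \<notin> K}"
      proof (rule less.hyps[of "U - {u}" A "insert u B" x z w])
        show "card (insert u B) \<le> card A" using 3 fin by (simp add: card_insert_if)
          show "2 * card ((U - {u}) \<union> A \<union> insert u B - K) < card ((U - {u}) \<union> A \<union> insert u B)"
          if "K \<in> {K \<in> \<A>. u \<in> K \<longrightarrow> x \<notin> K}" for K
          using prems(12)[of K] that unfolding unB by blast
      qed (use cardU prems(1-11) u in auto)
      show "card (U - {u}) \<le> p" using q prems(13) cardU by (simp split: if_splits)
    qed
    ultimately show ?thesis
      unfolding q using u prems(1,2,5) by (intro solvable.ask[of u n x]) auto
  qed
qed

text \<open>Shared by both problems: \<open>e\<close> is the cost of finishing when all chain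
  answers are "no". The last hypothesis says that the spies in \<open>{1..m}\<close> form an initial
  segment.\<close>

lemma solvable_along_chain:
  fixes correct :: "nat set \<Rightarrow> 'c \<Rightarrow> bool"
  assumes spy: "\<And>K p. p \<in> {1..n} - K \<Longrightarrow> correct K (spy p)"
    and closing: "\<And>\<B>. \<B> \<subseteq> \<C> \<Longrightarrow>
      (\<And>K i j. K \<in> \<B> \<Longrightarrow> 1 \<le> i \<Longrightarrow> i \<le> j \<Longrightarrow> j \<le> n \<Longrightarrow> i \<in> K \<Longrightarrow> j \<in> K) \<Longrightarrow>
      solvable n correct e \<B>"
    and majority: "\<And>K. K \<in> \<C> \<Longrightarrow> 2 * card ({1..n} - K) < n"
    and "1 \<le> m" "m \<le> n" "\<A> \<subseteq> \<C>"
    and "\<And>K i j. K \<in> \<A> \<Longrightarrow> 1 \<le> i \<Longrightarrow> i \<le> j \<Longrightarrow> j \<le> m \<Longrightarrow> i \<in> K \<Longrightarrow> j \<in> K"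
  shows "solvable n correct (n - m + e) \<A>"
  using assms(5,4,6,7)
proof (induction m arbitrary: \<A> rule: inc_induct)
  case base
  show ?case
    using closing[OF base(2), OF base(3)] by simp
next
  case (step m)
  have eq: "n - m + e = Suc (n - Suc m + e)" using step.hyps by simp
  have "solvable n correct (n - Suc m + e) {K \<in> \<A>. m \<in> K \<longrightarrow> Suc m \<in> K}"
  proof (rule step.IH)
    fix K i j
    assume "K \<in> {K \<in> \<A>. m \<in> K \<longrightarrow> Suc m \<in> K}" "1 \<le> i" "i \<le> j" "j \<le> Suc m" "i \<in> K"
    then show "j \<in> K"
      using step.prems(3)[of K i m] step.prems(3)[of K i j] by (auto simp: le_Suc_eq)
  qed (use step.prems in auto)
  moreover have "solvable n correct (n - Suc m + e) {K \<in> \<A>. m \<in> K \<longrightarrow> Suc m \<notin> K}"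
  proof (rule solvable_mono)
    show "solvable n correct (n - Suc m) {K \<in> \<A>. m \<in> K \<longrightarrow> Suc m \<notin> K}"
    \<comment> \<open>If \<open>m\<close> is a spy, so is everyone before; \<open>B\<close> is
      nonempty, so \<open>card U = n - Suc m\<close> questions suffice and \<open>e\<close> is
      spared.\<close>
    proof (rule solvable_with_candidate[where spy = spy and U = "{Suc (Suc m)..n}"
          and A = "{1..m}" and B = "{Suc m}" and x = m and z = m and w = "Suc m"])
      fix K assume K: "K \<in> {K \<in> \<A>. m \<in> K \<longrightarrow> Suc m \<notin> K}"
      have "{Suc (Suc m)..n} \<union> {1..m} \<union> {Suc m} = {1..n}"
        using step.hyps by auto
      then show "2 * card ({Suc (Suc m)..n} \<union> {1..m} \<union> {Suc m} - K)
          < card ({Suc (Suc m)..n} \<union> {1..m} \<union> {Suc m})"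
        using majority K step.prems(2) by auto
      show "{1..m} \<inter> K = {}" if "m \<notin> K"
        using step.prems(3)[of K _ m] K that by auto
    qed (use step.prems(1) step.hyps spy in auto)
  qed simp
  ultimately show ?case
    unfolding eq using step.prems(1) step.hyps by (intro solvable.ask[of m n "Suc m"]) auto
qed

section \<open>The exact values of both quantities\<close>

lemma assignments_majority:
  assumes "n < 2 * k" and "K \<in> assignments n k"
  shows "2 * card ({1..n} - K) < n"
proof -
  have K: "K \<subseteq> {1..n}" "k \<le> card K" using assms(2) by (auto simp: assignments_def)
  then have "card K \<le> n" using card_mono[of "{1..n}" K] by simp
  moreover have "card ({1..n} - K) = n - card K"
    using K(1) by (simp add: card_Diff_subset finite_subset)
  ultimately show ?thesis using K(2) assms(1) by linarith
qed

lemma single_spy_assignment: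
  assumes "k < n" and "p \<in> {1..n}"
  shows "{1..n} - {p} \<in> assignments n k"
  using assms by (auto simp: assignments_def card_Diff_singleton)

lemma T_tilde_S_eq:
  assumes "n < 2 * k" and "k < n"
  shows "T_tilde_S n k = enat (n - 1)"
  unfolding T_tilde_S_def
proof (rule questions_needed_eqI)
  let ?\<C> = "{K \<in> assignments n k. {1..n} - K \<noteq> {}}"
  have "solvable n (\<lambda>K p. p \<in> {1..n} - K) (n - 1 + 0) ?\<C>"
  proof (rule solvable_along_chain[where spy = id and \<C> = ?\<C>])
    fix \<B>
    assume "\<B> \<subseteq> ?\<C>"
      and "\<And>K i j. K \<in> \<B> \<Longrightarrow> 1 \<le> i \<Longrightarrow> i \<le> j \<Longrightarrow> j \<le> n \<Longrightarrow> i \<in> K \<Longrightarrow> j \<in> K"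
    \<comment> \<open>A nonempty initial segment of spies contains person 1.\<close>
    then show "solvable n (\<lambda>K p. p \<in> {1..n} - K) 0 \<B>"
      using assms by (intro solvable.conclude[of _ _ 1]) force
  next
    show "j \<in> K" if "1 \<le> i" "i \<le> j" "j \<le> 1" "i \<in> K" for K :: "nat set" and i j :: nat
      using that by (metis le_antisym le_trans)
  qed (use assms assignments_majority in auto)
  then show "solvable n (\<lambda>K p. p \<in> {1..n} - K) (n - 1) ?\<C>" by simp
  show "n - 1 \<le> q" if "solvable n (\<lambda>K p. p \<in> {1..n} - K) q ?\<C>" for q
  proof -
    have "{1..n} - {p} \<in> ?\<C>" if "p \<in> {1..n}" for p
      using single_spy_assignment[OF assms(2) that] that by auto
    then have "card {1..n} \<le> Suc q" by (intro suspects_le_if_solvable_spy[OF that]) auto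
    then show ?thesis by simp
  qed
qed

lemma T_bar_S_eq:
  assumes "n < 2 * k" and "k < n"
  shows "T_bar_S n k = enat n"
  unfolding T_bar_S_def
proof (rule questions_needed_eqI)
  have "solvable n (correct_verdict n) (n - 1 + 1) (assignments n k)"
  proof (rule solvable_along_chain[where spy = Spy and \<C> = "assignments n k"])
    fix \<B>
    assume sub: "\<B> \<subseteq> assignments n k"
      and chain: "\<And>K i j. K \<in> \<B> \<Longrightarrow> 1 \<le> i \<Longrightarrow> i \<le> j \<Longrightarrow> j \<le> n \<Longrightarrow> i \<in> K \<Longrightarrow> j \<in> K"
    \<comment> \<open>An initial segment containing \<open>n\<close> would make everyone a spy. So
      \<open>n\<close> answers truthfully about 1, and if 1 is a knight then all are.\<close>
    have last_knight: "n \<in> K" if K: "K \<in> \<B>" for K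
    proof (rule ccontr)
      assume "n \<notin> K"
      then have "{1..n} - K = {1..n}" using chain[OF K, of _ n] by auto
      then show False using assignments_majority[OF assms(1), of K] K sub by auto
    qed
    have "solvable n (correct_verdict n) 0 {K \<in> \<B>. n \<in> K \<longrightarrow> 1 \<notin> K}"
      using last_knight assms by (intro solvable.conclude[of _ _ "Spy 1"]) auto
    moreover have "solvable n (correct_verdict n) 0 {K \<in> \<B>. n \<in> K \<longrightarrow> 1 \<in> K}"
    proof (rule solvable.conclude[of _ _ All_Knights])
      fix K assume K: "K \<in> {K \<in> \<B>. n \<in> K \<longrightarrow> 1 \<in> K}"
      then have "{1..n} \<subseteq> K" using last_knight chain[of K 1] by auto
      then show "correct_verdict n K All_Knights"
        using K sub by (auto simp: assignments_def)
    qed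
    ultimately have "solvable n (correct_verdict n) (Suc 0) \<B>"
      using assms by (intro solvable.ask[of n n 1]) auto
    then show "solvable n (correct_verdict n) 1 \<B>" by simp
  next
    show "j \<in> K" if "1 \<le> i" "i \<le> j" "j \<le> 1" "i \<in> K" for K :: "nat set" and i j :: nat
      using that by (metis le_antisym le_trans)
  qed (use assms assignments_majority in auto)
  then show "solvable n (correct_verdict n) n (assignments n k)" using assms by simp
  show "n \<le> q" if "solvable n (correct_verdict n) q (assignments n k)" for q
    using suspects_le_if_solvable_verdict[OF that, of "{1..n}"]
      single_spy_assignment[OF assms(2)] assms(2) by (auto simp: assignments_def)
qed

theorem theorem2:
  fixes n k :: nat
  assumes "real n / 2 < real k" and "k < n"
  shows "T_tilde_S n k = enat (n - 1) \<and> T_bar_S n k = enat n"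
proof -
  have "n < 2 * k" using assms(1) by linarith
  then show ?thesis using assms(2) by (simp add: T_tilde_S_eq T_bar_S_eq)
qed

end
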